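(* Let $k$ be a field of positive characteristic, $G$ a finite group, and $V$ a finite rank monomial representation of $G$ over $k$. Then the invariant ring $(\mathrm{Sym}\,V)^G$ is $F$-pure.
   Context: Let $V$ be a finite rank $k$-vector space that is a $G$-module. A $k$-basis $\Gamma$ of $V$ is a monomial basis for the action of $G$ if for each $g\in G$ and $\gamma\in\Gamma$, one has $g\gamma\in k\gamma'$ for some $\gamma'\in\Gamma$. The $G$-module $V$ is a monomial representation of $G$ if $V$ admits a monomial basis. The action of $G$ on $V$ extends to an action on the symmetric algebra $\mathrm{Sym}\,V$ by degree-preserving $k$-algebra automorphisms. A ring $R$ of characteristic $p>0$ is $F$-pure if the Frobenius homomorphism $F\colon R\to R$, $r\mapsto r^p$, is pure, i.e., it remains injective after tensoring (over the source copy of $R$) with any $R$-module. *)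

theory Defs
  imports
    "HOL-Algebra.Algebra"
    "HOL-Algebra.Algebraic_Closure_Type"
    "HOL-Library.Poly_Mapping"
begin

section \<open>Tensor products, purity and F-purity\<close>

text \<open>
  The tensor product of \<open>R\<close>-modules is the free abelian group on pairs modulo the subgroup
  generated by the bilinearity relations. Only its underlying abelian group (written
  multiplicatively, as a factor group) is needed to speak about injectivity.
\<close>

definition tensor_relations ::
    "('r, 'x) ring_scheme \<Rightarrow> ('r, 'a) module \<Rightarrow> ('r, 'b) module \<Rightarrow> (('a \<times> 'b) \<Rightarrow>\<^sub>0 int) set" where
  "tensor_relations R A B =
     {frag_of (a \<oplus>\<^bsub>A\<^esub> a', b) - frag_of (a, b) - frag_of (a', b) | a a' b.
        a \<in> carrier A \<and> a' \<in> carrier A \<and> b \<in> carrier B}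
   \<union> {frag_of (a, b \<oplus>\<^bsub>B\<^esub> b') - frag_of (a, b) - frag_of (a, b') | a b b'.
        a \<in> carrier A \<and> b \<in> carrier B \<and> b' \<in> carrier B}
   \<union> {frag_of (r \<odot>\<^bsub>A\<^esub> a, b) - frag_of (a, r \<odot>\<^bsub>B\<^esub> b) | r a b.
        r \<in> carrier R \<and> a \<in> carrier A \<and> b \<in> carrier B}"

definition tensor_subgroup ::
    "('r, 'x) ring_scheme \<Rightarrow> ('r, 'a) module \<Rightarrow> ('r, 'b) module \<Rightarrow> (('a \<times> 'b) \<Rightarrow>\<^sub>0 int) set" where
  "tensor_subgroup R A B =
     generate (free_Abelian_group (carrier A \<times> carrier B)) (tensor_relations R A B)"

definition tensor_product ::
    "('r, 'x) ring_scheme \<Rightarrow> ('r, 'a) module \<Rightarrow> ('r, 'b) module \<Rightarrow> (('a \<times> 'b) \<Rightarrow>\<^sub>0 int) set monoid" where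
  "tensor_product R A B =
     free_Abelian_group (carrier A \<times> carrier B) Mod tensor_subgroup R A B"

text \<open>
  For an \<open>R\<close>-linear map \<open>f\<close> from \<open>A\<close> to \<open>A'\<close>, the map induced by \<open>f\<close> and the identity of \<open>B\<close>:
  the class of \<open>x\<close> is sent to the class of the image of \<open>x\<close>.
\<close>

definition tensor_map ::
    "('r, 'x) ring_scheme \<Rightarrow> ('r, 'c) module \<Rightarrow> ('r, 'b) module \<Rightarrow> ('a \<Rightarrow> 'c)
       \<Rightarrow> (('a \<times> 'b) \<Rightarrow>\<^sub>0 int) set \<Rightarrow> (('c \<times> 'b) \<Rightarrow>\<^sub>0 int) set" where
  "tensor_map R A' B f C =
     (\<Union>x\<in>C. tensor_subgroup R A' B
        #>\<^bsub>free_Abelian_group (carrier A' \<times> carrier B)\<^esub>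
        frag_extend (\<lambda>(a, b). frag_of (f a, b)) x)"

definition restrict_scalars :: "('r \<Rightarrow> 's) \<Rightarrow> ('s, 'x) ring_scheme \<Rightarrow> ('r, 's) module" where
  "restrict_scalars \<phi> S =
     \<lparr>carrier = carrier S, monoid.mult = (\<otimes>\<^bsub>S\<^esub>), one = \<one>\<^bsub>S\<^esub>,
      ring.zero = \<zero>\<^bsub>S\<^esub>, add = (\<oplus>\<^bsub>S\<^esub>), module.smult = (\<lambda>r s. \<phi> r \<otimes>\<^bsub>S\<^esub> s)\<rparr>"

text \<open>
  HOL cannot quantify over all types inside a definition, so the type of the elements of the
  test modules is a parameter; a theorem in which this type is a free type variable covers
  all modules.
\<close>

definition pure_ring_hom ::
    "'m itself \<Rightarrow> ('r, 'x) ring_scheme \<Rightarrow> ('s, 'y) ring_scheme \<Rightarrow> ('r \<Rightarrow> 's) \<Rightarrow> bool" where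
  "pure_ring_hom _ R S \<phi> \<longleftrightarrow>
     \<phi> \<in> ring_hom R S \<and>
     (\<forall>M :: ('r, 'm) module. Module.module R M \<longrightarrow>
        inj_on (tensor_map R (restrict_scalars \<phi> S) M \<phi>)
          (carrier (tensor_product R (restrict_scalars id R) M)))"

definition has_char :: "('r, 'x) ring_scheme \<Rightarrow> nat \<Rightarrow> bool" where
  "has_char R p \<longleftrightarrow> (\<forall>n::nat. add_pow R n \<one>\<^bsub>R\<^esub> = \<zero>\<^bsub>R\<^esub> \<longleftrightarrow> p dvd n)"

definition frobenius :: "nat \<Rightarrow> ('r, 'x) ring_scheme \<Rightarrow> 'r \<Rightarrow> 'r" where
  "frobenius p R r = r [^]\<^bsub>R\<^esub> p"

definition F_pure :: "'m itself \<Rightarrow> nat \<Rightarrow> ('r, 'x) ring_scheme \<Rightarrow> bool" where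
  "F_pure T p R \<longleftrightarrow>
     cring R \<and> p > 0 \<and> has_char R p \<and> pure_ring_hom T R R (frobenius p R)"


section \<open>The symmetric algebra\<close>

text \<open>
  The symmetric algebra of \<open>V\<close>, without choosing a basis: the polynomial ring with one variable
  for every vector \<open>v\<close> of \<open>V\<close>, modulo the ideal making \<open>v \<mapsto> sym_var v\<close> linear.
  A monomial is a finitely supported exponent function \<open>'v \<Rightarrow>\<^sub>0 nat\<close>.
\<close>

type_synonym ('v, 'k) vpoly = "('v \<Rightarrow>\<^sub>0 nat) \<Rightarrow>\<^sub>0 'k"

definition sym_var :: "'v \<Rightarrow> ('v, 'k::field) vpoly" where
  "sym_var v = Poly_Mapping.single (Poly_Mapping.single v 1) 1"

definition sym_const :: "'k \<Rightarrow> ('v, 'k::field) vpoly" where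
  "sym_const c = Poly_Mapping.single 0 c"

definition sym_relations ::
    "('k::field \<Rightarrow> 'v::ab_group_add \<Rightarrow> 'v) \<Rightarrow> ('v, 'k) vpoly set" where
  "sym_relations scale =
     {sym_var (v + w) - sym_var v - sym_var w | v w. True}
   \<union> {sym_var (scale c v) - sym_const c * sym_var v | c v. True}"

definition sym_ideal ::
    "('k::field \<Rightarrow> 'v::ab_group_add \<Rightarrow> 'v) \<Rightarrow> ('v, 'k) vpoly set" where
  "sym_ideal scale = genideal ring_of_type_algebra (sym_relations scale)"

definition Sym :: "('k::field \<Rightarrow> 'v::ab_group_add \<Rightarrow> 'v) \<Rightarrow> ('v, 'k) vpoly set ring" where
  "Sym scale = ring_of_type_algebra Quot sym_ideal scale"

definition var_subst :: "('v \<Rightarrow> 'v) \<Rightarrow> ('v, 'k::field) vpoly \<Rightarrow> ('v, 'k) vpoly" where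
  "var_subst h f =
     (\<Sum>m\<in>Poly_Mapping.keys f. sym_const (Poly_Mapping.lookup f m) *
        (\<Prod>v\<in>Poly_Mapping.keys m. sym_var (h v) ^ Poly_Mapping.lookup m v))"

text \<open>
  The algebra endomorphism of \<open>Sym V\<close> extending a linear endomorphism \<open>h\<close> of \<open>V\<close>:
  the class of \<open>f\<close> is sent to the class of \<open>var_subst h f\<close>.
\<close>

definition Sym_map ::
    "('k::field \<Rightarrow> 'v::ab_group_add \<Rightarrow> 'v) \<Rightarrow> ('v \<Rightarrow> 'v)
       \<Rightarrow> ('v, 'k) vpoly set \<Rightarrow> ('v, 'k) vpoly set" where
  "Sym_map scale h C = (\<Union>f\<in>C. sym_ideal scale +>\<^bsub>ring_of_type_algebra\<^esub> var_subst h f)"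


section \<open>Monomial representations and invariants\<close>

locale linear_representation =
  vector_space scale + group_action G UNIV act
  for scale :: "'k::field \<Rightarrow> 'v::ab_group_add \<Rightarrow> 'v"
    and G :: "('g, 'x) monoid_scheme" (structure)
    and act :: "'g \<Rightarrow> 'v \<Rightarrow> 'v" +
  assumes act_linear: "g \<in> carrier G \<Longrightarrow> Vector_Spaces.linear scale scale (act g)"
begin

definition monomial_basis :: "'v set \<Rightarrow> bool" where
  "monomial_basis \<Gamma> \<longleftrightarrow>
     independent \<Gamma> \<and> span \<Gamma> = UNIV \<and>
     (\<forall>g\<in>carrier G. \<forall>\<gamma>\<in>\<Gamma>. \<exists>\<gamma>'\<in>\<Gamma>. \<exists>c. act g \<gamma> = scale c \<gamma>')"

definition monomial_representation :: bool where
  "monomial_representation \<longleftrightarrow> (\<exists>\<Gamma>. monomial_basis \<Gamma>)"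

definition invariant_ring :: "('v, 'k) vpoly set ring" where
  "invariant_ring =
     (Sym scale)\<lparr>carrier :=
        {C \<in> carrier (Sym scale). \<forall>g\<in>carrier G. Sym_map scale (act g) C = C}\<rparr>"

end

end

theory Submission
  imports Defs
begin

text \<open>
  Let \<open>p\<close> be the characteristic and let \<open>\<Gamma>\<close> be a monomial basis, so that the symmetric algebra is the
  polynomial ring \<open>S = k[\<Gamma>]\<close>. Choose an additive map \<open>\<tau>\<close> on \<open>k\<close> with \<open>\<tau>(a\<^bsup>p\<^esup> b) = a \<tau>(b)\<close> and
  \<open>\<tau>(1) = 1\<close> (\<open>exists_p_inverse_linear\<close>). The operator \<open>\<theta>\<close> on \<open>S\<close> that sends \<open>c x\<^bsup>p m\<^esup>\<close> to
  \<open>\<tau>(c) x\<^bsup>m\<^esup>\<close> and kills all monomials whose exponent is not divisible by \<open>p\<close> satisfies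
  \<open>\<theta>(f\<^bsup>p\<^esup> h) = f \<theta>(h)\<close> and \<open>\<theta>(1) = 1\<close> (\<open>splitting_power_mult\<close>): it splits the Frobenius of \<open>S\<close>.

  This particular splitting commutes with \<open>G\<close> (\<open>splitting_twist\<close>). An element \<open>g\<close> sends \<open>x\<^bsup>m\<^esup>\<close>
  to \<open>d x\<^bsup>m'\<^esup>\<close>, where \<open>p\<close> divides \<open>m'\<close> exactly when it divides \<open>m\<close>; and when \<open>m = p n\<close> the scalar
  \<open>d\<close> is the \<open>p\<close>-th power of the scalar belonging to \<open>x\<^bsup>n\<^esup>\<close>, which \<open>\<tau>\<close> lets through as its
  \<open>p\<close>-th root. Hence \<open>\<theta>\<close> maps invariants to invariants and splits the Frobenius of the invariant
  ring, and a split homomorphism is pure (\<open>pure_ring_hom_if_split\<close>).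

  Since the symmetric algebra is defined without a basis, as a quotient of the polynomial ring on
  all vectors, elements are compared through their normal forms in \<open>k[\<Gamma>]\<close>
  (\<open>sym_class_eq_iff_normal_form\<close>).
\<close>

section \<open>Split homomorphisms are pure\<close>

lemma tensor_relations_add_left:
  "a \<in> carrier A \<Longrightarrow> a' \<in> carrier A \<Longrightarrow> b \<in> carrier B \<Longrightarrow>
    frag_of (a \<oplus>\<^bsub>A\<^esub> a', b) - frag_of (a, b) - frag_of (a', b) \<in> tensor_relations R A B"
  unfolding tensor_relations_def by (intro UnI1 CollectI exI conjI) (rule refl | assumption)+

lemma tensor_relations_add_right:
  "a \<in> carrier A \<Longrightarrow> b \<in> carrier B \<Longrightarrow> b' \<in> carrier B \<Longrightarrow>
    frag_of (a, b \<oplus>\<^bsub>B\<^esub> b') - frag_of (a, b) - frag_of (a, b') \<in> tensor_relations R A B"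
  unfolding tensor_relations_def
  by (rule UnI1, rule UnI2, intro CollectI exI conjI) (rule refl | assumption)+

lemma tensor_relations_smult:
  "r \<in> carrier R \<Longrightarrow> a \<in> carrier A \<Longrightarrow> b \<in> carrier B \<Longrightarrow>
    frag_of (r \<odot>\<^bsub>A\<^esub> a, b) - frag_of (a, r \<odot>\<^bsub>B\<^esub> b) \<in> tensor_relations R A B"
  unfolding tensor_relations_def by (intro UnI2 CollectI exI conjI) (rule refl | assumption)+

lemma tensor_relations_cases [consumes 1, case_names add_left add_right smult]:
  assumes "h \<in> tensor_relations R A B"
  obtains
    a a' b where "a \<in> carrier A" "a' \<in> carrier A" "b \<in> carrier B"
      "h = frag_of (a \<oplus>\<^bsub>A\<^esub> a', b) - frag_of (a, b) - frag_of (a', b)"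
  | a b b' where "a \<in> carrier A" "b \<in> carrier B" "b' \<in> carrier B"
      "h = frag_of (a, b \<oplus>\<^bsub>B\<^esub> b') - frag_of (a, b) - frag_of (a, b')"
  | r a b where "r \<in> carrier R" "a \<in> carrier A" "b \<in> carrier B"
      "h = frag_of (r \<odot>\<^bsub>A\<^esub> a, b) - frag_of (a, r \<odot>\<^bsub>B\<^esub> b)"
  using assms unfolding tensor_relations_def by (elim UnE CollectE exE conjE) metis+

text \<open>
  The map induced by \<open>\<psi>\<close> on free abelian groups sends each bilinearity relation to the relation
  of the same kind, so it descends to tensor products.
\<close>

lemma tensor_subgroup_frag_extend:
  fixes R (structure)
  assumes A: "Module.module R A" and A': "Module.module R A'" and B: "Module.module R B"
    and closed: "\<And>a. a \<in> carrier A' \<Longrightarrow> \<psi> a \<in> carrier A"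
    and add: "\<And>a a'. a \<in> carrier A' \<Longrightarrow> a' \<in> carrier A' \<Longrightarrow> \<psi> (a \<oplus>\<^bsub>A'\<^esub> a') = \<psi> a \<oplus>\<^bsub>A\<^esub> \<psi> a'"
    and \<psi>_smult: "\<And>r a. r \<in> carrier R \<Longrightarrow> a \<in> carrier A' \<Longrightarrow> \<psi> (r \<odot>\<^bsub>A'\<^esub> a) = r \<odot>\<^bsub>A\<^esub> \<psi> a"
    and x: "x \<in> tensor_subgroup R A' B"
  shows "frag_extend (\<lambda>(a, b). frag_of (\<psi> a, b)) x \<in> tensor_subgroup R A B"
proof -
  interpret A': Module.module R A' by fact
  interpret B: Module.module R B by fact
  have keys: "Poly_Mapping.keys h \<subseteq> carrier A' \<times> carrier B" if "h \<in> tensor_relations R A' B" for h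
    using that unfolding tensor_relations_def
    by (auto dest!: subsetD[OF keys_diff] simp: keys_frag_of)
  let ?\<psi> = "frag_extend (\<lambda>(a, b). frag_of (\<psi> a, b))"
  have rel: "?\<psi> h \<in> tensor_relations R A B" if "h \<in> tensor_relations R A' B" for h
    using that
  proof (cases rule: tensor_relations_cases)
    case (add_left a a' b)
    then show ?thesis
      using tensor_relations_add_left[of "\<psi> a" A "\<psi> a'" b B R] closed
      by (simp add: frag_extend_diff add)
  next
    case (add_right a b b')
    then show ?thesis
      using tensor_relations_add_right[of "\<psi> a" A b B b' R] closed
      by (simp add: frag_extend_diff)
  next
    case (smult r a b)
    then show ?thesis
      using tensor_relations_smult[of r R "\<psi> a" A b B] closed
      by (simp add: frag_extend_diff \<psi>_smult)
  qed
  have keys2: "Poly_Mapping.keys h \<subseteq> carrier A \<times> carrier B" if "h \<in> tensor_relations R A B" for h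
  proof -
    interpret A: Module.module R A by fact
    show ?thesis using that unfolding tensor_relations_def
    by (auto dest!: subsetD[OF keys_diff] simp: keys_frag_of)
  qed
  show ?thesis
    using x unfolding tensor_subgroup_def
  proof (induction x rule: generate.induct)
    case one
    then show ?case using generate.one[of "free_Abelian_group (carrier A \<times> carrier B)"] by simp
  next
    case (incl h)
    then show ?case by (intro generate.incl rel)
  next
    case (inv h)
    then show ?case
      using generate.inv[OF rel[OF inv], of "free_Abelian_group (carrier A \<times> carrier B)"]
        keys[OF inv] keys2[OF rel[OF inv]]
      by (simp add: frag_extend_minus)
  next
    case (eng h1 h2)
    then show ?case
      using generate.eng[OF eng.IH] by (simp add: frag_extend_add)
  qed
qed

lemma module_restrict_scalars:
  assumes "\<phi> \<in> ring_hom R S" "cring R" "cring S"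
  shows "Module.module R (restrict_scalars \<phi> S)"
proof -
  interpret R: cring R by fact
  interpret S: cring S by fact
  interpret \<phi>: ring_hom_cring R S \<phi>
    using assms by (simp add: ring_hom_cring_def ring_hom_cring_axioms_def)
  have "abelian_group (restrict_scalars \<phi> S)"
    by (rule abelian_groupI) (auto simp: restrict_scalars_def S.a_ac intro: S.l_neg)
  then show ?thesis
    by (intro moduleI assms)
       (auto simp: restrict_scalars_def S.l_distr S.r_distr S.m_assoc)
qed

text \<open>
  If \<open>\<psi>\<close> is an \<open>R\<close>-linear retraction of \<open>\<phi>\<close>, then after tensoring with \<open>M\<close> the map induced by
  \<open>\<psi>\<close> is still a retraction of the one induced by \<open>\<phi>\<close>. The proof works with representatives:
  if the images of \<open>x\<close> and \<open>z\<close> differ by a relation \<open>h\<close>, then \<open>x\<close> and \<open>z\<close> differ by the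
  relation \<open>\<psi> h\<close>.
\<close>

lemma pure_ring_hom_if_split:
  fixes R :: "('r, 'x) ring_scheme" and S :: "('s, 'y) ring_scheme"
  assumes R: "cring R" and S: "cring S" and \<phi>: "\<phi> \<in> ring_hom R S"
    and closed: "\<And>s. s \<in> carrier S \<Longrightarrow> \<psi> s \<in> carrier R"
    and add: "\<And>s t. s \<in> carrier S \<Longrightarrow> t \<in> carrier S \<Longrightarrow> \<psi> (s \<oplus>\<^bsub>S\<^esub> t) = \<psi> s \<oplus>\<^bsub>R\<^esub> \<psi> t"
    and smult: "\<And>r s. r \<in> carrier R \<Longrightarrow> s \<in> carrier S \<Longrightarrow> \<psi> (\<phi> r \<otimes>\<^bsub>S\<^esub> s) = r \<otimes>\<^bsub>R\<^esub> \<psi> s"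
    and split: "\<And>r. r \<in> carrier R \<Longrightarrow> \<psi> (\<phi> r) = r"
  shows "pure_ring_hom TYPE('m) R S \<phi>"
  unfolding pure_ring_hom_def
proof (intro conjI allI impI inj_onI \<phi>)
  fix M :: "('r, 'm) module" and C D
  assume M: "Module.module R M"
  define A where "A = restrict_scalars id R"
  define A' where "A' = restrict_scalars \<phi> S"
  let ?F = "free_Abelian_group (carrier A \<times> carrier M)"
  let ?F' = "free_Abelian_group (carrier A' \<times> carrier M)"
  let ?H = "tensor_subgroup R A M" and ?H' = "tensor_subgroup R A' M"
  let ?\<phi> = "frag_extend (\<lambda>(a, b). frag_of (\<phi> a, b)) :: ('r \<times> 'm \<Rightarrow>\<^sub>0 int) \<Rightarrow> _"
  let ?\<psi> = "frag_extend (\<lambda>(a, b). frag_of (\<psi> a, b)) :: ('s \<times> 'm \<Rightarrow>\<^sub>0 int) \<Rightarrow> _"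
  assume C: "C \<in> carrier (tensor_product R A M)" and D: "D \<in> carrier (tensor_product R A M)"
    and eq: "tensor_map R A' M \<phi> C = tensor_map R A' M \<phi> D"
  have A: "Module.module R A"
    unfolding A_def by (intro module_restrict_scalars R) (auto simp: ring_hom_def)
  have A': "Module.module R A'"
    unfolding A'_def by (intro module_restrict_scalars R S \<phi>)
  interpret A: Module.module R A by fact
  interpret M: Module.module R M by fact
  interpret F: group ?F by simp
  have rel: "tensor_relations R A M \<subseteq> carrier ?F"
    unfolding tensor_relations_def
    by (auto dest!: subsetD[OF keys_diff] simp: keys_frag_of)
  have H: "subgroup ?H ?F"
    unfolding tensor_subgroup_def by (rule F.generate_is_subgroup[OF rel])
  have retract: "?\<psi> (?\<phi> x) = x" if "x \<in> carrier ?F" for x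
  proof -
    have "Poly_Mapping.keys x \<subseteq> carrier A \<times> carrier M" using that by simp
    then show ?thesis
      by (induction x rule: frag_induction)
         (auto simp: frag_extend_diff A_def restrict_scalars_def split)
  qed
  from C obtain x where x: "x \<in> carrier ?F" "C = ?H #>\<^bsub>?F\<^esub> x"
    by (auto simp: tensor_product_def FactGroup_def RCOSETS_def)
  from D obtain y where y: "y \<in> carrier ?F" "D = ?H #>\<^bsub>?F\<^esub> y"
    by (auto simp: tensor_product_def FactGroup_def RCOSETS_def)
  have xC: "x \<in> C" using F.rcos_self[OF x(1) H] x(2) by simp
  have zero: "0 \<in> ?H'"
    unfolding tensor_subgroup_def using generate.one[of ?F'] by simp
  have "?\<phi> x \<in> tensor_map R A' M \<phi> C"
    unfolding tensor_map_def r_coset_def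
    using xC zero by (intro UN_I[of x] UN_I[of 0]) simp_all
  then obtain z h where z: "z \<in> D" "h \<in> ?H'" "?\<phi> x = h + ?\<phi> z"
    unfolding eq unfolding tensor_map_def r_coset_def by auto
  have zF: "z \<in> carrier ?F"
    using z(1) y F.r_coset_subset_G[OF subgroup.subset[OF H] y(1)] by blast
  have "?\<psi> h \<in> ?H"
    using A A' M _ _ _ z(2)
    by (rule tensor_subgroup_frag_extend)
       (auto simp: A_def A'_def restrict_scalars_def closed add smult)
  moreover have "x = ?\<psi> h + z"
    using arg_cong[OF z(3), of ?\<psi>] by (simp add: frag_extend_add retract x(1) zF del: carrier_free_Abelian_group_iff)
  ultimately have "x \<in> ?H #>\<^bsub>?F\<^esub> z"
    by (auto simp: r_coset_def)
  then have "?H #>\<^bsub>?F\<^esub> x = ?H #>\<^bsub>?F\<^esub> z"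
    using F.repr_independence[OF _ zF H] by simp
  also have "\<dots> = D"
    using F.repr_independence[OF _ y(1) H, of z] z(1) y(2) by simp
  finally show "C = D" using x(2) by simp
qed

section \<open>Substitution for the variables of a polynomial\<close>

lemma poly_mapping_induct_keys [consumes 1, case_names zero single add]:
  assumes "Poly_Mapping.keys f \<subseteq> S"
    and zero: "P 0" and single: "\<And>m c. m \<in> S \<Longrightarrow> P (Poly_Mapping.single m c)"
    and add: "\<And>f g. P f \<Longrightarrow> P g \<Longrightarrow> P (f + g)"
  shows "P (f :: 'a \<Rightarrow>\<^sub>0 'b::comm_monoid_add)"
  using assms(1)
proof (induction f rule: update_induct)
  case const
  show ?case by (rule zero)
next
  case (update f a b)
  have "Poly_Mapping.update a b f = f + Poly_Mapping.single a b"
    using update.hyps(1)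
    by (intro poly_mapping_eqI) (auto simp: lookup_update lookup_add lookup_single in_keys_iff when_def)
  moreover have "Poly_Mapping.keys f \<subseteq> S" "a \<in> S"
    using update.prems update.hyps by (auto simp: keys_update)
  ultimately show ?case using single add update.IH by auto
qed

lemma poly_mapping_induct_single [case_names single add]:
  assumes "\<And>m c. P (Poly_Mapping.single m c)" and "\<And>f g. P f \<Longrightarrow> P g \<Longrightarrow> P (f + g)"
  shows "P (f :: 'a \<Rightarrow>\<^sub>0 'b::comm_monoid_add)"
  using assms assms(1)[of undefined 0]
  by (induction f rule: poly_mapping_induct_keys[OF subset_UNIV]) auto

definition mono_eval :: "('v \<Rightarrow> 'a::comm_monoid_mult) \<Rightarrow> ('v \<Rightarrow>\<^sub>0 nat) \<Rightarrow> 'a" where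
  "mono_eval F m = (\<Prod>v\<in>Poly_Mapping.keys m. F v ^ Poly_Mapping.lookup m v)"

definition eval_vars :: "('v \<Rightarrow> ('w, 'k::field) vpoly) \<Rightarrow> ('v, 'k) vpoly \<Rightarrow> ('w, 'k) vpoly" where
  "eval_vars F f =
     (\<Sum>m\<in>Poly_Mapping.keys f. sym_const (Poly_Mapping.lookup f m) * mono_eval F m)"

lemma var_subst_eq_eval_vars: "var_subst h = eval_vars (\<lambda>v. sym_var (h v))"
  by (simp add: fun_eq_iff var_subst_def eval_vars_def mono_eval_def)

lemma mono_eval_superset:
  assumes "finite S" "Poly_Mapping.keys m \<subseteq> S"
  shows "mono_eval F m = (\<Prod>v\<in>S. F v ^ Poly_Mapping.lookup m v)"
  unfolding mono_eval_def using assms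
  by (intro prod.mono_neutral_left) (auto simp: in_keys_iff)

lemma mono_eval_0 [simp]: "mono_eval F 0 = 1"
  by (simp add: mono_eval_def)

lemma mono_eval_single [simp]: "mono_eval F (Poly_Mapping.single v n) = F v ^ n"
  by (cases "n = 0") (auto simp: mono_eval_def)

lemma mono_eval_add: "mono_eval F (m + n) = mono_eval F m * mono_eval F n"
proof -
  let ?S = "Poly_Mapping.keys m \<union> Poly_Mapping.keys n"
  have "Poly_Mapping.keys (m + n) \<subseteq> ?S" by (rule keys_add)
  then show ?thesis
    by (subst (1 2 3) mono_eval_superset[of ?S])
       (auto simp: lookup_add power_add prod.distrib)
qed

lemma sym_const_add: "sym_const (c + d) = sym_const c + sym_const d"
  by (simp add: sym_const_def single_add)

lemma sym_const_mult: "sym_const (c * d) = sym_const c * sym_const d"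
  by (simp add: sym_const_def mult_single)

lemma sym_const_0 [simp]: "sym_const 0 = 0"
  by (simp add: sym_const_def)

lemma sym_const_1 [simp]: "sym_const 1 = 1"
  by (simp add: sym_const_def)

lemma eval_vars_superset:
  assumes "finite S" "Poly_Mapping.keys f \<subseteq> S"
  shows "eval_vars F f = (\<Sum>m\<in>S. sym_const (Poly_Mapping.lookup f m) * mono_eval F m)"
  unfolding eval_vars_def using assms
  by (intro sum.mono_neutral_left) (auto simp: in_keys_iff)

lemma eval_vars_add: "eval_vars F (f + g) = eval_vars F f + eval_vars F g"
proof -
  let ?S = "Poly_Mapping.keys f \<union> Poly_Mapping.keys g"
  have "Poly_Mapping.keys (f + g) \<subseteq> ?S" by (rule keys_add)
  then show ?thesis
    by (subst (1 2 3) eval_vars_superset[of ?S])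
       (auto simp: lookup_add sym_const_add distrib_right sum.distrib)
qed

lemma eval_vars_single [simp]:
  "eval_vars F (Poly_Mapping.single m c) = sym_const c * mono_eval F m"
  by (cases "c = 0") (auto simp: eval_vars_def)

lemma eval_vars_mult: "eval_vars F (f * g) = eval_vars F f * eval_vars F g"
proof (induction f rule: poly_mapping_induct_single)
  case (single m c)
  show ?case
    by (induction g rule: poly_mapping_induct_single)
       (simp_all add: mult_single distrib_left distrib_right eval_vars_add sym_const_mult mono_eval_add mult_ac)
qed (simp add: distrib_right eval_vars_add)

lemma eval_vars_0 [simp]: "eval_vars F 0 = 0"
  by (simp add: eval_vars_def)

lemma eval_vars_const [simp]: "eval_vars F (sym_const c) = sym_const c"
  by (subst sym_const_def) simp

lemma eval_vars_1 [simp]: "eval_vars F 1 = 1"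
  using eval_vars_const[of F 1] by simp

lemma eval_vars_var [simp]: "eval_vars F (sym_var v) = F v"
  by (simp add: sym_var_def)

lemma eval_vars_diff: "eval_vars F (f - g) = eval_vars F f - eval_vars F g"
  using eval_vars_add[of F "f - g" g] by simp

lemma eval_vars_uminus: "eval_vars F (- f) = - eval_vars F f"
  using eval_vars_diff[of F 0 f] by simp

lemma eval_vars_power: "eval_vars F (f ^ n) = eval_vars F f ^ n"
  by (induction n) (simp_all add: eval_vars_mult)

lemma sym_var_power: "sym_var v ^ n = Poly_Mapping.single (Poly_Mapping.single v n) 1"
  by (induction n) (simp_all add: sym_var_def mult_single flip: single_add)

text \<open>
  Every monomial is a product of variables; this is what makes an algebra homomorphism determined
  by its values on the variables, in the form of the induction rule \<open>vpoly_induct\<close> below.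
\<close>

lemma single_eq_mono_eval:
  fixes m :: "'v \<Rightarrow>\<^sub>0 nat" and c :: "'k::field"
  shows "Poly_Mapping.single m c = sym_const c * mono_eval sym_var m"
proof -
  have "(Poly_Mapping.single m 1 :: ('v, 'k) vpoly) = mono_eval sym_var m"
  proof (induction m rule: poly_mapping_induct_single)
    case (add f g)
    have "Poly_Mapping.single (f + g) 1 = Poly_Mapping.single f 1 * (Poly_Mapping.single g 1 :: ('v, 'k) vpoly)"
      by (simp add: mult_single)
    then show ?case by (simp only: add mono_eval_add)
  qed (simp add: sym_var_power)
  then show ?thesis
    by (metis add_0 mult.right_neutral mult_single sym_const_def)
qed

lemma vpoly_induct [case_names const var add mult]:
  assumes const: "\<And>c. P (sym_const c)" and var: "\<And>v. P (sym_var v)"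
    and add: "\<And>f g. P f \<Longrightarrow> P g \<Longrightarrow> P (f + g)"
    and mult: "\<And>f g. P f \<Longrightarrow> P g \<Longrightarrow> P (f * g)"
  shows "P (f :: ('v, 'k::field) vpoly)"
proof (induction f rule: poly_mapping_induct_single)
  case (single m c)
  have one: "P 1" using const[of 1] by simp
  have "P (f ^ n)" if "P f" for f n
    using that one by (induction n) (auto intro: mult)
  then have "P (\<Prod>v\<in>S. sym_var v ^ Poly_Mapping.lookup m v)" for S
    using one by (induction S rule: infinite_finite_induct) (auto intro: mult var)
  then show ?case
    unfolding single_eq_mono_eval mono_eval_def by (intro mult const)
qed (fact add)

lemma eval_vars_eval_vars: "eval_vars F (eval_vars E f) = eval_vars (\<lambda>v. eval_vars F (E v)) f"
  by (induction f rule: vpoly_induct) (simp_all add: eval_vars_add eval_vars_mult)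

lemma CHAR_vpoly: "CHAR(('v, 'k::field) vpoly) = CHAR('k)"
proof -
  have "(of_nat n :: ('v, 'k) vpoly) = 0 \<longleftrightarrow> (of_nat n :: 'k) = 0" for n
  proof
    assume "(of_nat n :: ('v, 'k) vpoly) = 0"
    from arg_cong[OF this, of "\<lambda>f. Poly_Mapping.lookup f 0"] show "(of_nat n :: 'k) = 0"
      by (simp add: lookup_of_nat)
  next
    assume "(of_nat n :: 'k) = 0"
    then show "(of_nat n :: ('v, 'k) vpoly) = 0"
      by (simp flip: single_of_nat)
  qed
  then show ?thesis
    by (intro CHAR_eqI) (auto simp: of_nat_eq_0_iff_char_dvd)
qed

section \<open>A splitting of Frobenius\<close>

text \<open>
  Frobenius makes \<open>k\<close> a vector space over itself, with \<open>a\<close> acting as multiplication by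
  \<open>a\<^bsup>p\<^esup>\<close>. As \<open>1\<close> is independent in it and extends to a basis, some linear
  functional takes the value \<open>1\<close> there.
\<close>

lemma exists_p_inverse_linear:
  assumes "CHAR('k::field) > 0"
  obtains \<tau> :: "'k::field \<Rightarrow> 'k" where "\<tau> 1 = 1" "\<And>a b. \<tau> (a + b) = \<tau> a + \<tau> b"
    "\<And>a b. \<tau> (a ^ CHAR('k::field) * b) = a * \<tau> b"
proof -
  let ?p = "CHAR('k)"
  have prime: "Factorial_Ring.prime ?p" using assms by (rule prime_CHAR_semidom)
  interpret pair: vector_space_pair "\<lambda>a b :: 'k. a ^ ?p * b" "(*) :: 'k \<Rightarrow> 'k \<Rightarrow> 'k"
    by unfold_locales
       (auto simp: algebra_simps freshmans_dream[OF prime] power_mult_distrib)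
  have "\<not> pair.vs1.dependent {1 :: 'k}"
    by simp
  from pair.linear_independent_extend[OF this, of "\<lambda>_. 1"]
  obtain \<tau> where \<tau>: "Vector_Spaces.linear (\<lambda>a b :: 'k. a ^ ?p * b) (*) \<tau>" "\<tau> 1 = 1"
    by auto
  interpret \<tau>: Vector_Spaces.linear "\<lambda>a b :: 'k. a ^ ?p * b" "(*)" \<tau> by fact
  show ?thesis
    by (rule that[OF \<tau>(2) \<tau>.add \<tau>.scale])
qed

definition dilate :: "nat \<Rightarrow> ('v \<Rightarrow>\<^sub>0 nat) \<Rightarrow> ('v \<Rightarrow>\<^sub>0 nat)" where
  "dilate p m = Poly_Mapping.map ((*) p) m"

lemma lookup_dilate [simp]: "Poly_Mapping.lookup (dilate p m) v = p * Poly_Mapping.lookup m v"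
  unfolding dilate_def by transfer (simp add: when_def)

lemma keys_dilate: "p > 0 \<Longrightarrow> Poly_Mapping.keys (dilate p m) = Poly_Mapping.keys m"
  by (auto simp: in_keys_iff)

lemma inj_dilate: "p > 0 \<Longrightarrow> inj (dilate p)"
  by (intro injI poly_mapping_eqI) (metis lookup_dilate mult_cancel1 less_numeral_extra(3))

lemma dilate_add: "dilate p (m + n) = dilate p m + dilate p n"
  by (intro poly_mapping_eqI) (simp add: lookup_add distrib_left)

lemma dilate_add_cancel:
  assumes "p > 0" "dilate p l = dilate p m + n"
  shows "n = dilate p (l - m)"
proof (intro poly_mapping_eqI)
  fix v
  have "p * Poly_Mapping.lookup l v = p * Poly_Mapping.lookup m v + Poly_Mapping.lookup n v"
    using arg_cong[OF assms(2), of "\<lambda>f. Poly_Mapping.lookup f v"] by (simp add: lookup_add)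
  then show "Poly_Mapping.lookup n v = Poly_Mapping.lookup (dilate p (l - m)) v"
    by (simp add: lookup_minus diff_mult_distrib2)
qed

lemma single_power:
  "Poly_Mapping.single m c ^ n = Poly_Mapping.single (dilate n m) (c ^ n)"
  for c :: "'k::comm_semiring_1"
proof (induction n)
  case 0
  have "dilate 0 m = 0" by (intro poly_mapping_eqI) simp
  then show ?case by simp
next
  case (Suc n)
  have "m + dilate n m = dilate (Suc n) m"
    by (intro poly_mapping_eqI) (simp add: lookup_add)
  with Suc show ?case by (simp add: mult_single)
qed

text \<open>
  The operator \<open>c x\<^bsup>p m\<^esup> \<mapsto> \<tau>(c) x\<^bsup>m\<^esup>\<close> that kills the monomials which are not \<open>p\<close>-th powers.
\<close>

definition frobenius_splitting :: "nat \<Rightarrow> ('k \<Rightarrow> 'k) \<Rightarrow> ('v, 'k::field) vpoly \<Rightarrow> ('v, 'k) vpoly" where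
  "frobenius_splitting p \<tau> f = Poly_Mapping.map \<tau> (Poly_Mapping.map_key (dilate p) f)"

locale p_inverse_linear =
  fixes p :: nat and \<tau> :: "'k::field \<Rightarrow> 'k"
  assumes p: "p = CHAR('k)" "p > 0"
    and \<tau>_1: "\<tau> 1 = 1"
    and \<tau>_add: "\<tau> (a + b) = \<tau> a + \<tau> b"
    and \<tau>_scale: "\<tau> (a ^ p * b) = a * \<tau> b"
begin

abbreviation splitting :: "('v, 'k) vpoly \<Rightarrow> ('v, 'k) vpoly" where
  "splitting \<equiv> frobenius_splitting p \<tau>"

lemma prime_p: "Factorial_Ring.prime p"
  using p prime_CHAR_semidom[where 'a = 'k] by simp

lemma frobenius_add: "(f + g) ^ p = f ^ p + g ^ p" for f g :: "('v, 'k) vpoly"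
  using prime_p p by (intro freshmans_dream) (simp_all add: CHAR_vpoly)

lemma \<tau>_0 [simp]: "\<tau> 0 = 0"
  using \<tau>_scale[of 0 0] p(2) by simp

lemma lookup_splitting:
  "Poly_Mapping.lookup (splitting f) m = \<tau> (Poly_Mapping.lookup f (dilate p m))"
  unfolding frobenius_splitting_def
  by (simp add: map.rep_eq map_key.rep_eq[OF inj_dilate[OF p(2)]] when_def)

lemma splitting_add: "splitting (f + g) = splitting f + splitting g"
  by (intro poly_mapping_eqI) (simp add: lookup_splitting lookup_add \<tau>_add)

lemma splitting_0 [simp]: "splitting 0 = 0"
  by (intro poly_mapping_eqI) (simp add: lookup_splitting)

lemma splitting_single_dilate:
  "splitting (Poly_Mapping.single (dilate p m) c) = Poly_Mapping.single m (\<tau> c)"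
  using inj_dilate[OF p(2)]
  by (intro poly_mapping_eqI) (auto simp: lookup_splitting lookup_single when_def dest: injD)

lemma splitting_single_other:
  "m \<notin> range (dilate p) \<Longrightarrow> splitting (Poly_Mapping.single m c) = 0"
  by (intro poly_mapping_eqI) (auto simp: lookup_splitting lookup_single when_def)

lemma splitting_1: "splitting 1 = 1"
proof -
  have "dilate p 0 = 0" by (intro poly_mapping_eqI) simp
  then show ?thesis
    by (metis splitting_single_dilate single_one \<tau>_1)
qed

text \<open>
  On monomials: \<open>p m + n\<close> is a multiple of \<open>p\<close> exactly when \<open>n\<close> is, and then the quotients differ
  by \<open>m\<close>. The general case is additivity in both arguments, where Frobenius is additive because
  the characteristic is \<open>p\<close>.
\<close>

lemma splitting_power_mult: "splitting (f ^ p * g) = f * splitting g"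
  for f g :: "('v, 'k) vpoly"
proof (induction f rule: poly_mapping_induct_single)
  case (single m c)
  show ?case
  proof (induction g rule: poly_mapping_induct_single)
    case (single n d)
    show ?case
    proof (cases "n \<in> range (dilate p)")
      case True
      then obtain l where l: "n = dilate p l" by blast
      show ?thesis
        by (simp add: l single_power mult_single splitting_single_dilate \<tau>_scale flip: dilate_add)
    next
      case False
      then have "dilate p m + n \<notin> range (dilate p)"
        by (auto dest!: sym[of "_ + _"] dilate_add_cancel[OF p(2)])
      with False show ?thesis
        by (simp add: single_power mult_single splitting_single_other)
    qed
  qed (simp add: distrib_left splitting_add)
qed (simp add: frobenius_add distrib_right splitting_add)

end

section \<open>Normal forms in the symmetric algebra\<close>

interpretation type_ring: cring "ring_of_type_algebra :: 'a::comm_ring_1 ring"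
  by (rule cring_from_type_algebra)

lemma type_ring_simps [simp]:
  "carrier ring_of_type_algebra = UNIV" "f \<otimes>\<^bsub>ring_of_type_algebra\<^esub> g = f * g"
  "f \<oplus>\<^bsub>ring_of_type_algebra\<^esub> g = f + g" "\<one>\<^bsub>ring_of_type_algebra\<^esub> = 1"
  "\<zero>\<^bsub>ring_of_type_algebra\<^esub> = 0"
  by (simp_all add: ring_of_type_algebra_def)

lemma type_ring_uminus [simp]: "\<ominus>\<^bsub>ring_of_type_algebra\<^esub> f = - (f :: 'a::comm_ring_1)"
  by (rule type_ring.minus_equality) simp_all

lemma type_ring_minus [simp]: "f \<ominus>\<^bsub>ring_of_type_algebra\<^esub> g = f - (g :: 'a::comm_ring_1)"
  by (simp add: a_minus_def)

lemma ideal_sym_ideal: "ideal (sym_ideal scale) ring_of_type_algebra"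
  unfolding sym_ideal_def by (rule type_ring.genideal_ideal) simp

lemma sym_ideal_add: "f \<in> sym_ideal scale \<Longrightarrow> g \<in> sym_ideal scale \<Longrightarrow> f + g \<in> sym_ideal scale"
  using additive_subgroup.a_closed[OF ideal.axioms(1)[OF ideal_sym_ideal]] by force

lemma sym_ideal_mult: "f \<in> sym_ideal scale \<Longrightarrow> g * f \<in> sym_ideal scale"
  using ideal.I_l_closed[OF ideal_sym_ideal] by force

lemma sym_ideal_0 [simp]: "0 \<in> sym_ideal scale"
  using additive_subgroup.zero_closed[OF ideal.axioms(1)[OF ideal_sym_ideal]] by force

lemma sym_relations_in_ideal: "f \<in> sym_relations scale \<Longrightarrow> f \<in> sym_ideal scale"
  unfolding sym_ideal_def using type_ring.genideal_self[of "sym_relations scale"] by auto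

text \<open>
  The assignments \<open>v \<mapsto> F v\<close> that factor through the symmetric algebra.
\<close>

definition linear_vars ::
    "('k::field \<Rightarrow> 'v::ab_group_add \<Rightarrow> 'v) \<Rightarrow> ('v \<Rightarrow> ('w, 'k) vpoly) \<Rightarrow> bool" where
  "linear_vars scale F \<longleftrightarrow>
     (\<forall>v w. F (v + w) = F v + F w) \<and> (\<forall>c v. F (scale c v) = sym_const c * F v)"

lemma eval_vars_sym_ideal:
  assumes F: "linear_vars scale F" and f: "f \<in> sym_ideal scale"
  shows "eval_vars F f = 0"
proof -
  have "ideal {f. eval_vars F f = 0} ring_of_type_algebra"
  proof (rule idealI)
    show "subgroup {f. eval_vars F f = 0} (add_monoid ring_of_type_algebra)"
      by (rule type_ring.add.subgroupI)
         (auto simp: eval_vars_add eval_vars_uminus intro: exI[of _ 0])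
  qed (auto simp: eval_vars_mult intro: type_ring.ring_axioms)
  then have "sym_ideal scale \<subseteq> {f. eval_vars F f = 0}"
    unfolding sym_ideal_def
    by (rule type_ring.genideal_minimal)
       (use F in \<open>auto simp: sym_relations_def linear_vars_def eval_vars_diff eval_vars_mult\<close>)
  with f show ?thesis by auto
qed

abbreviation sym_class ::
    "('k::field \<Rightarrow> 'v::ab_group_add \<Rightarrow> 'v) \<Rightarrow> ('v, 'k) vpoly \<Rightarrow> ('v, 'k) vpoly set" where
  "sym_class scale f \<equiv> sym_ideal scale +>\<^bsub>ring_of_type_algebra\<^esub> f"

lemma sym_class_eq_iff: "sym_class scale f = sym_class scale g \<longleftrightarrow> f - g \<in> sym_ideal scale"
  using type_ring.quotient_eq_iff_same_a_r_cos[OF ideal_sym_ideal, of f g] by simp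

lemma mem_sym_class: "g \<in> sym_class scale f \<longleftrightarrow> g - f \<in> sym_ideal scale"
proof -
  have "g \<in> sym_class scale f \<longleftrightarrow> (\<exists>h\<in>sym_ideal scale. g = h + f)"
    by (auto simp: a_r_coset_def')
  also have "\<dots> \<longleftrightarrow> g - f \<in> sym_ideal scale"
    by (metis add_diff_cancel_right' diff_add_cancel)
  finally show ?thesis .
qed

lemma carrier_Sym: "carrier (Sym scale) = range (sym_class scale)"
  unfolding Sym_def FactRing_def A_RCOSETS_def' by auto

lemma cring_Sym: "cring (Sym scale)"
  unfolding Sym_def by (intro ideal.quotient_is_cring ideal_sym_ideal type_ring.cring_axioms)

lemma sym_class_ring_hom: "sym_class scale \<in> ring_hom ring_of_type_algebra (Sym scale)"
  unfolding Sym_def by (intro ideal.rcos_ring_hom ideal_sym_ideal)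

lemma sym_class_mult: "sym_class scale f \<otimes>\<^bsub>Sym scale\<^esub> sym_class scale g = sym_class scale (f * g)"
  using ring_hom_mult[OF sym_class_ring_hom, of f g] by simp

lemma sym_class_add: "sym_class scale f \<oplus>\<^bsub>Sym scale\<^esub> sym_class scale g = sym_class scale (f + g)"
  using ring_hom_add[OF sym_class_ring_hom, of f g] by simp

lemma one_Sym: "\<one>\<^bsub>Sym scale\<^esub> = sym_class scale 1"
  using ring_hom_one[OF sym_class_ring_hom[of scale]] by simp

lemma zero_Sym: "\<zero>\<^bsub>Sym scale\<^esub> = sym_class scale 0"
proof -
  interpret Sym: cring "Sym scale" by (rule cring_Sym)
  show ?thesis
    using ring_hom_zero[OF sym_class_ring_hom[of scale] type_ring.ring_axioms Sym.ring_axioms] by simp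
qed

lemma sym_class_uminus: "\<ominus>\<^bsub>Sym scale\<^esub> sym_class scale f = sym_class scale (- f)"
proof -
  interpret Sym: cring "Sym scale" by (rule cring_Sym)
  show ?thesis
    by (rule Sym.minus_equality) (simp_all add: sym_class_add zero_Sym carrier_Sym)
qed

lemma Sym_map_class:
  fixes scale :: "'k::field \<Rightarrow> 'v::ab_group_add \<Rightarrow> 'v"
  assumes h: "Vector_Spaces.linear scale scale h"
  shows "Sym_map scale h (sym_class scale f) = sym_class scale (var_subst h f)"
proof -
  interpret h: Vector_Spaces.linear scale scale h by fact
  have "ideal {f. var_subst h f \<in> sym_ideal scale} ring_of_type_algebra"
  proof (rule idealI)
    show "subgroup {f. var_subst h f \<in> sym_ideal scale} (add_monoid ring_of_type_algebra)"
    proof (rule type_ring.add.subgroupI)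
      fix f assume f: "f \<in> {f. var_subst h f \<in> sym_ideal scale}"
      have "var_subst h (- f) = (- 1) * var_subst h f"
        by (simp add: var_subst_eq_eval_vars eval_vars_uminus)
      with f sym_ideal_mult show "\<ominus>\<^bsub>ring_of_type_algebra\<^esub> f \<in> {f. var_subst h f \<in> sym_ideal scale}"
        by (metis (mono_tags) mem_Collect_eq type_ring_uminus)
    qed (auto simp: var_subst_eq_eval_vars eval_vars_add intro: exI[of _ 0] sym_ideal_add)
  next
    fix f g assume f: "f \<in> {f. var_subst h f \<in> sym_ideal scale}"
    then show "g \<otimes>\<^bsub>ring_of_type_algebra\<^esub> f \<in> {f. var_subst h f \<in> sym_ideal scale}"
      by (simp add: var_subst_eq_eval_vars eval_vars_mult sym_ideal_mult)
    then show "f \<otimes>\<^bsub>ring_of_type_algebra\<^esub> g \<in> {f. var_subst h f \<in> sym_ideal scale}"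
      by (simp add: mult.commute)
  qed (rule type_ring.ring_axioms)
  moreover have "sym_relations scale \<subseteq> {f. var_subst h f \<in> sym_ideal scale}"
  proof
    fix f assume "f \<in> sym_relations scale"
    then consider (add) v w where "f = sym_var (v + w) - sym_var v - sym_var w"
      | (scale) c v where "f = sym_var (scale c v) - sym_const c * sym_var v"
      unfolding sym_relations_def by blast
    then have "var_subst h f \<in> sym_relations scale"
    proof cases
      case add
      then have "var_subst h f = sym_var (h v + h w) - sym_var (h v) - sym_var (h w)"
        by (simp add: var_subst_eq_eval_vars eval_vars_diff h.add)
      then show ?thesis unfolding sym_relations_def by blast
    next
      case scale
      then have "var_subst h f = sym_var (scale c (h v)) - sym_const c * sym_var (h v)"
        by (simp add: var_subst_eq_eval_vars eval_vars_diff eval_vars_mult h.scale)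
      then show ?thesis unfolding sym_relations_def by blast
    qed
    then show "f \<in> {f. var_subst h f \<in> sym_ideal scale}"
      by (simp add: sym_relations_in_ideal)
  qed
  ultimately have "sym_ideal scale \<subseteq> {f. var_subst h f \<in> sym_ideal scale}"
    unfolding sym_ideal_def[of scale] by (rule type_ring.genideal_minimal)
  then have "sym_class scale (var_subst h f') = sym_class scale (var_subst h f)"
    if "f' \<in> sym_class scale f" for f'
    using that unfolding mem_sym_class sym_class_eq_iff
    by (auto simp: var_subst_eq_eval_vars simp flip: eval_vars_diff)
  moreover have "f \<in> sym_class scale f"
    by (simp add: mem_sym_class)
  ultimately show ?thesis
    unfolding Sym_map_def by blast
qed

text \<open>
  Replacing every vector by its linear form in a basis \<open>\<Gamma>\<close> is an algebra endomorphism
  \<open>normal_form\<close> of the polynomial ring with kernel \<open>sym_ideal\<close>. It identifies the symmetric algebra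
  with the polynomials in the variables from \<open>\<Gamma>\<close>, called \<open>supported\<close> below.
\<close>

locale finite_basis = vector_space scale
  for scale :: "'k::field \<Rightarrow> 'v::ab_group_add \<Rightarrow> 'v" +
  fixes \<Gamma> :: "'v set"
  assumes finite_basis: "finite \<Gamma>" and independent_basis: "independent \<Gamma>"
    and span_basis: "span \<Gamma> = UNIV"
begin

definition coord_form :: "'v \<Rightarrow> ('v, 'k) vpoly" where
  "coord_form v = (\<Sum>\<gamma>\<in>\<Gamma>. sym_const (representation \<Gamma> v \<gamma>) * sym_var \<gamma>)"

abbreviation normal_form :: "('v, 'k) vpoly \<Rightarrow> ('v, 'k) vpoly" where
  "normal_form \<equiv> eval_vars coord_form"

lemma linear_coord_form: "linear_vars scale coord_form"
  unfolding linear_vars_def coord_form_def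
  by (simp add: representation_add representation_scale independent_basis span_basis
      sym_const_add sym_const_mult distrib_right sum.distrib sum_distrib_left mult.assoc)

lemma coord_form_basis:
  assumes "\<gamma> \<in> \<Gamma>" shows "coord_form \<gamma> = sym_var \<gamma>"
proof -
  have "coord_form \<gamma> = (\<Sum>\<delta>\<in>\<Gamma>. if \<delta> = \<gamma> then sym_var \<gamma> else 0)"
    unfolding coord_form_def
    by (intro sum.cong) (auto simp: representation_basis[OF independent_basis assms])
  then show ?thesis using assms finite_basis by simp
qed

lemma sym_var_sum_in_ideal:
  "sym_var (\<Sum>\<gamma>\<in>S. scale (c \<gamma>) \<gamma>) - (\<Sum>\<gamma>\<in>S. sym_const (c \<gamma>) * sym_var \<gamma>) \<in> sym_ideal scale"
  if "finite S"
  using that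
proof (induction S)
  case empty
  have "sym_var (scale 0 0) - sym_const 0 * sym_var 0 \<in> sym_ideal scale"
    by (rule sym_relations_in_ideal, unfold sym_relations_def, blast)
  then show ?case by simp
next
  case (insert \<gamma> S)
  let ?v = "scale (c \<gamma>) \<gamma>" and ?w = "\<Sum>\<gamma>\<in>S. scale (c \<gamma>) \<gamma>"
  let ?W = "\<Sum>\<gamma>\<in>S. sym_const (c \<gamma>) * sym_var \<gamma>"
  have "sym_var (?v + ?w) - sym_var ?v - sym_var ?w \<in> sym_ideal scale"
    "sym_var ?v - sym_const (c \<gamma>) * sym_var \<gamma> \<in> sym_ideal scale"
    by (rule sym_relations_in_ideal, unfold sym_relations_def, blast)+
  from sym_ideal_add[OF sym_ideal_add[OF this] insert.IH] insert.hyps show ?case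
    by (simp add: algebra_simps)
qed

text \<open>
  Modulo the ideal a variable equals its linear form, because \<open>sym_var\<close> is linear there; sums and
  products inherit this congruence.
\<close>

lemma diff_normal_form_in_ideal: "f - normal_form f \<in> sym_ideal scale"
proof (induction f rule: vpoly_induct)
  case (const c)
  show ?case by simp
next
  case (var v)
  have "(\<Sum>\<gamma>\<in>\<Gamma>. scale (representation \<Gamma> v \<gamma>) \<gamma>) = v"
    by (rule sum_representation_eq) (auto simp: independent_basis span_basis finite_basis)
  then show ?case
    using sym_var_sum_in_ideal[OF finite_basis, of "representation \<Gamma> v"]
    by (simp add: coord_form_def)
next
  case (add f g)
  from sym_ideal_add[OF this] show ?case
    by (simp add: eval_vars_add algebra_simps)
next
  case (mult f g)
  from sym_ideal_add[OF sym_ideal_mult[OF mult(2), of f] sym_ideal_mult[OF mult(1), of "normal_form g"]]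
  show ?case
    by (simp add: eval_vars_mult algebra_simps)
qed

lemma eval_vars_normal_form:
  assumes "linear_vars scale F"
  shows "eval_vars F (normal_form f) = eval_vars F f"
  using eval_vars_sym_ideal[OF assms diff_normal_form_in_ideal[of f]]
  by (simp add: eval_vars_diff)

lemma mem_sym_ideal_iff: "f \<in> sym_ideal scale \<longleftrightarrow> normal_form f = 0"
  using eval_vars_sym_ideal[OF linear_coord_form] diff_normal_form_in_ideal[of f] by auto

lemma sym_class_eq_iff_normal_form:
  "sym_class scale f = sym_class scale g \<longleftrightarrow> normal_form f = normal_form g"
  by (simp add: sym_class_eq_iff mem_sym_ideal_iff eval_vars_diff)

lemma sym_class_normal_form: "sym_class scale (normal_form f) = sym_class scale f"
  by (simp add: sym_class_eq_iff_normal_form eval_vars_normal_form linear_coord_form)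

definition supported :: "('v, 'k) vpoly \<Rightarrow> bool" where
  "supported f \<longleftrightarrow> Poly_Mapping.keys f \<subseteq> {m. Poly_Mapping.keys m \<subseteq> \<Gamma>}"

lemma supported_add: "supported f \<Longrightarrow> supported g \<Longrightarrow> supported (f + g)"
  unfolding supported_def using keys_add[of f g] by blast

lemma supported_mult:
  assumes "supported f" "supported g" shows "supported (f * g)"
  unfolding supported_def
proof clarify
  fix m v assume m: "m \<in> Poly_Mapping.keys (f * g)" "v \<in> Poly_Mapping.keys m"
  obtain a b where "m = a + b" "a \<in> Poly_Mapping.keys f" "b \<in> Poly_Mapping.keys g"
    using keys_mult[of f g] m(1) by blast
  with m(2) assms show "v \<in> \<Gamma>"
    using keys_add[of a b] unfolding supported_def by blast
qed

lemma supported_const: "supported (sym_const c)"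
  by (simp add: supported_def sym_const_def)

lemma supported_coord_form: "supported (coord_form v)"
proof -
  have "supported (\<Sum>\<gamma>\<in>S. sym_const (c \<gamma>) * sym_var \<gamma>)" if "finite S" "S \<subseteq> \<Gamma>" for S c
    using that
    by (induction S)
       (auto intro!: supported_add supported_mult supported_const, auto simp: supported_def sym_var_def)
  then show ?thesis
    unfolding coord_form_def using finite_basis by simp
qed

lemma supported_eval_vars: "(\<And>v. supported (F v)) \<Longrightarrow> supported (eval_vars F f)"
  by (induction f rule: vpoly_induct)
     (simp_all add: eval_vars_add eval_vars_mult supported_const supported_add supported_mult)

lemma normal_form_supported:
  assumes "supported f" shows "normal_form f = f"
proof -
  have "mono_eval coord_form m = mono_eval sym_var m" if "Poly_Mapping.keys m \<subseteq> \<Gamma>" for m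
    using that unfolding mono_eval_def by (intro prod.cong) (auto simp: coord_form_basis)
  then have "normal_form f = eval_vars sym_var f"
    unfolding eval_vars_def using assms by (intro sum.cong) (auto simp: supported_def)
  also have "eval_vars sym_var f = f"
    by (induction f rule: vpoly_induct) (simp_all add: eval_vars_add eval_vars_mult)
  finally show ?thesis .
qed

end

section \<open>The splitting on invariants\<close>

locale monomial_action =
  linear_representation scale G act + finite_basis scale \<Gamma> + p_inverse_linear p \<tau>
  for scale :: "'k::field \<Rightarrow> 'v::ab_group_add \<Rightarrow> 'v"
    and G :: "('g, 'x) monoid_scheme" (structure)
    and act :: "'g \<Rightarrow> 'v \<Rightarrow> 'v"
    and \<Gamma> :: "'v set" and p :: nat and \<tau> :: "'k \<Rightarrow> 'k" +
  assumes monomial: "\<And>g \<gamma>. g \<in> carrier G \<Longrightarrow> \<gamma> \<in> \<Gamma> \<Longrightarrow> \<exists>\<gamma>'\<in>\<Gamma>. \<exists>c. act g \<gamma> = scale c \<gamma>'"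
begin

text \<open>
  The action of \<open>g\<close> on the symmetric algebra, read on normal forms.
\<close>

definition twist :: "'g \<Rightarrow> ('v, 'k) vpoly \<Rightarrow> ('v, 'k) vpoly" where
  "twist g = eval_vars (\<lambda>v. coord_form (act g v))"

lemma linear_twist:
  assumes "g \<in> carrier G" shows "linear_vars scale (\<lambda>v. coord_form (act g v))"
proof -
  interpret g: Vector_Spaces.linear scale scale "act g" by (rule act_linear[OF assms])
  show ?thesis
    using linear_coord_form by (simp add: linear_vars_def g.add g.scale)
qed

lemma normal_form_var_subst: "normal_form (var_subst (act g) f) = twist g f"
  by (simp add: var_subst_eq_eval_vars eval_vars_eval_vars twist_def)

lemma twist_normal_form: "g \<in> carrier G \<Longrightarrow> twist g (normal_form f) = twist g f"
  unfolding twist_def by (intro eval_vars_normal_form linear_twist)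

lemma supported_twist: "supported (twist g f)"
  unfolding twist_def by (intro supported_eval_vars supported_coord_form)

lemma twist_inv_twist:
  assumes g: "g \<in> carrier G" and f: "supported f"
  shows "twist (inv g) (twist g f) = f"
proof -
  interpret G: group G using group_hom by (rule group_hom.axioms)
  have act: "act (inv g) (act g v) = v" for v
  proof -
    have "act (inv g) (act g v) = act (inv g \<otimes> g) v"
      using g by (intro composition_rule[symmetric]) auto
    also have "\<dots> = v"
      using g fun_cong[OF id_eq_one, of v] by simp
    finally show ?thesis .
  qed
  have "twist (inv g) (twist g f) = twist (inv g) (normal_form (var_subst (act g) f))"
    by (simp add: normal_form_var_subst)
  also have "\<dots> = twist (inv g) (var_subst (act g) f)"
    using g by (intro twist_normal_form) simp
  also have "\<dots> = normal_form f"
    by (simp add: twist_def var_subst_eq_eval_vars eval_vars_eval_vars act)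
  finally show ?thesis using f by (simp add: normal_form_supported)
qed

text \<open>
  The only place where the basis has to be monomial: \<open>g\<close> sends a variable from \<open>\<Gamma>\<close> to a scalar
  multiple of another one, hence a monomial to a scalar multiple of a monomial.
\<close>

lemma twist_monomial:
  assumes g: "g \<in> carrier G" and m: "Poly_Mapping.keys m \<subseteq> \<Gamma>"
  obtains m' d where "twist g (Poly_Mapping.single m 1) = Poly_Mapping.single m' d"
proof -
  let ?term = "\<lambda>f :: ('v, 'k) vpoly. \<exists>m c. f = Poly_Mapping.single m c"
  have one: "?term 1" by (metis single_one)
  have mult: "?term (f * g)" if "?term f" "?term g" for f g
    using that by (metis mult_single)
  have var: "?term (coord_form (act g \<gamma>))" if \<gamma>: "\<gamma> \<in> \<Gamma>" for \<gamma>
  proof -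
    obtain \<gamma>' c where \<gamma>': "\<gamma>' \<in> \<Gamma>" "act g \<gamma> = scale c \<gamma>'"
      using monomial[OF g \<gamma>] by blast
    then have "coord_form (act g \<gamma>) = sym_const c * sym_var \<gamma>'"
      using linear_coord_form by (simp add: linear_vars_def coord_form_basis)
    then have "coord_form (act g \<gamma>) = Poly_Mapping.single (Poly_Mapping.single \<gamma>' 1) c"
      by (simp add: sym_const_def sym_var_def mult_single)
    then show ?thesis by blast
  qed
  have "?term (\<Prod>v\<in>S. coord_form (act g v) ^ Poly_Mapping.lookup m v)"
    if "finite S" "S \<subseteq> \<Gamma>" for S
    using that
  proof (induction S)
    case (insert v S)
    have "?term (coord_form (act g v) ^ n)" for n
    proof (induction n)
      case 0
      show ?case using one by simp
    next
      case (Suc n)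
      show ?case unfolding power_Suc using insert.prems by (intro mult var Suc) simp
    qed
    with insert show ?case by (simp add: mult)
  next
    case empty
    show ?case using one by simp
  qed
  from this[OF finite_keys m] show ?thesis
    using that by (auto simp: twist_def mono_eval_def)
qed

lemma twist_single_dilate:
  assumes "twist g (Poly_Mapping.single n 1) = Poly_Mapping.single n' d"
  shows "twist g (Poly_Mapping.single (dilate p n) c) = Poly_Mapping.single (dilate p n') (c * d ^ p)"
proof -
  have "Poly_Mapping.single (dilate p n) c = sym_const c * Poly_Mapping.single n 1 ^ p"
    by (simp add: single_power sym_const_def mult_single)
  then have "twist g (Poly_Mapping.single (dilate p n) c) = sym_const c * Poly_Mapping.single n' d ^ p"
    using assms unfolding twist_def
    by (simp only: eval_vars_mult eval_vars_power eval_vars_const)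
  then show ?thesis
    by (simp add: single_power sym_const_def mult_single)
qed

lemma supported_splitting: "supported f \<Longrightarrow> supported (splitting f)"
  unfolding supported_def
proof clarify
  fix m v
  assume f: "Poly_Mapping.keys f \<subseteq> {m. Poly_Mapping.keys m \<subseteq> \<Gamma>}"
    and m: "m \<in> Poly_Mapping.keys (splitting f)" and v: "v \<in> Poly_Mapping.keys m"
  from m have "dilate p m \<in> Poly_Mapping.keys f"
    by (auto simp: in_keys_iff lookup_splitting)
  with f have "Poly_Mapping.keys (dilate p m) \<subseteq> \<Gamma>" by blast
  with v show "v \<in> \<Gamma>" by (auto simp: keys_dilate[OF p(2)])
qed

text \<open>
  It suffices to look at a term \<open>c x\<^bsup>m\<^esup>\<close>. If \<open>m = p n\<close> and \<open>g\<close> sends \<open>x\<^bsup>n\<^esup>\<close> to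
  \<open>d x\<^bsup>n'\<^esup>\<close>, then it sends the term to \<open>c d\<^bsup>p\<^esup> x\<^bsup>p n'\<^esup>\<close>, and \<open>\<tau>\<close> takes the factor
  \<open>d\<^bsup>p\<^esup>\<close> out as \<open>d\<close>. If \<open>m\<close> is not a multiple of \<open>p\<close>, neither is the exponent of the image, for
  otherwise applying the inverse of \<open>g\<close> would exhibit \<open>x\<^bsup>m\<^esup>\<close> as a scalar multiple of a
  \<open>p\<close>-th power of a monomial.
\<close>

lemma splitting_twist:
  assumes g: "g \<in> carrier G" and f: "supported f"
  shows "splitting (twist g f) = twist g (splitting f)"
  using f unfolding supported_def
proof (induction f rule: poly_mapping_induct_keys)
  case zero
  show ?case by (simp add: twist_def)
next
  case (add f h)
  then show ?case by (simp add: twist_def eval_vars_add splitting_add)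
next
  case (single m c)
  then have m: "Poly_Mapping.keys m \<subseteq> \<Gamma>" by simp
  show ?case
  proof (cases "m \<in> range (dilate p)")
    case True
    then obtain n where n: "m = dilate p n" by blast
    with m have "Poly_Mapping.keys n \<subseteq> \<Gamma>" using p(2) by (simp add: keys_dilate)
    then obtain n' d where d: "twist g (Poly_Mapping.single n 1) = Poly_Mapping.single n' d"
      using twist_monomial[OF g] by blast
    have "splitting (twist g (Poly_Mapping.single m c)) = Poly_Mapping.single n' (d * \<tau> c)"
      by (simp add: n twist_single_dilate[OF d] splitting_single_dilate \<tau>_scale mult.commute[of c])
    also have "\<dots> = twist g (sym_const (\<tau> c) * Poly_Mapping.single n 1)"
      using d unfolding twist_def
      by (simp only: eval_vars_mult eval_vars_const) (simp add: sym_const_def mult_single mult.commute)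
    also have "\<dots> = twist g (splitting (Poly_Mapping.single m c))"
      by (simp add: n splitting_single_dilate sym_const_def mult_single)
    finally show ?thesis .
  next
    case False
    have "splitting (twist g (Poly_Mapping.single m c)) = 0"
    proof (cases "c = 0")
      case True
      then show ?thesis by (simp add: twist_def)
    next
      case c: False
      obtain m' d where d: "twist g (Poly_Mapping.single m 1) = Poly_Mapping.single m' d"
        using twist_monomial[OF g m] by blast
      have "twist g (Poly_Mapping.single m c) = twist g (sym_const c * Poly_Mapping.single m 1)"
        by (simp add: sym_const_def mult_single)
      also have "\<dots> = sym_const c * Poly_Mapping.single m' d"
        using d unfolding twist_def by (simp only: eval_vars_mult eval_vars_const)
      finally have tw: "twist g (Poly_Mapping.single m c) = Poly_Mapping.single m' (c * d)"
        by (simp add: sym_const_def mult_single)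
      have inv_tw: "twist (inv g) (Poly_Mapping.single m' (c * d)) = Poly_Mapping.single m c"
        using twist_inv_twist[OF g, of "Poly_Mapping.single m c"] m
        by (simp add: tw supported_def split: if_splits)
      have "c * d \<noteq> 0"
      proof
        assume cd: "c * d = 0"
        have "Poly_Mapping.single m c = 0"
          using inv_tw by (simp add: cd twist_def)
        with c show False by (metis keys_single keys_zero insert_not_empty)
      qed
      have "m' \<notin> range (dilate p)"
      proof
        assume "m' \<in> range (dilate p)"
        then obtain n where n: "m' = dilate p n" by blast
        have "supported (Poly_Mapping.single m' (c * d))"
          using supported_twist[of g "Poly_Mapping.single m c"] by (simp add: tw)
        with n \<open>c * d \<noteq> 0\<close> have "Poly_Mapping.keys n \<subseteq> \<Gamma>"
          using p(2) by (simp add: supported_def keys_dilate)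
        moreover have "inv g \<in> carrier G"
          using g group.inv_closed[of G g] group_hom.axioms(1)[OF group_hom] by simp
        ultimately obtain n' e where "twist (inv g) (Poly_Mapping.single n 1) = Poly_Mapping.single n' e"
          using twist_monomial by blast
        from twist_single_dilate[OF this, of "c * d"] inv_tw
        have "Poly_Mapping.single (dilate p n') (c * d * e ^ p) = Poly_Mapping.single m c"
          by (simp add: n)
        with c have "m = dilate p n'"
          by (metis keys_single singleton_inject empty_not_insert)
        with False show False by blast
      qed
      then show ?thesis by (simp add: tw splitting_single_other)
    qed
    with False show ?thesis by (simp add: splitting_single_other twist_def)
  qed
qed

abbreviation cls :: "('v, 'k) vpoly \<Rightarrow> ('v, 'k) vpoly set" where
  "cls \<equiv> sym_class scale"

definition invariant :: "('v, 'k) vpoly \<Rightarrow> bool" where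
  "invariant f \<longleftrightarrow> (\<forall>g\<in>carrier G. twist g f = normal_form f)"

lemma carrier_invariant_ring: "carrier invariant_ring = cls ` Collect invariant"
proof -
  have "Sym_map scale (act g) (cls f) = cls f \<longleftrightarrow> twist g f = normal_form f"
    if "g \<in> carrier G" for g f
    by (simp add: Sym_map_class act_linear that sym_class_eq_iff_normal_form normal_form_var_subst)
  then show ?thesis
    unfolding invariant_ring_def carrier_Sym invariant_def by (simp add: set_eq_iff) blast
qed

lemma invariant_ring_simps:
  "\<one>\<^bsub>invariant_ring\<^esub> = cls 1" "\<zero>\<^bsub>invariant_ring\<^esub> = cls 0"
  "cls f \<otimes>\<^bsub>invariant_ring\<^esub> cls g = cls (f * g)"
  "cls f \<oplus>\<^bsub>invariant_ring\<^esub> cls g = cls (f + g)"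
  by (simp_all add: invariant_ring_def one_Sym zero_Sym sym_class_mult sym_class_add)

lemma cring_invariant_ring: "cring invariant_ring"
proof -
  interpret Sym: cring "Sym scale" by (rule cring_Sym)
  have "subring (carrier invariant_ring) (Sym scale)"
  proof (rule Sym.subringI)
    show "carrier invariant_ring \<subseteq> carrier (Sym scale)"
      by (auto simp: carrier_invariant_ring carrier_Sym)
    show "\<one>\<^bsub>Sym scale\<^esub> \<in> carrier invariant_ring"
      by (auto simp: carrier_invariant_ring one_Sym invariant_def twist_def)
  next
    fix C assume "C \<in> carrier invariant_ring"
    then obtain f where "C = cls f" "invariant f" by (auto simp: carrier_invariant_ring)
    moreover then have "invariant (- f)"
      by (simp add: invariant_def twist_def eval_vars_uminus)
    ultimately show "\<ominus>\<^bsub>Sym scale\<^esub> C \<in> carrier invariant_ring"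
      by (auto simp: carrier_invariant_ring sym_class_uminus)
  next
    fix C D assume "C \<in> carrier invariant_ring" "D \<in> carrier invariant_ring"
    then obtain f h where "C = cls f" "invariant f" "D = cls h" "invariant h"
      by (auto simp: carrier_invariant_ring)
    moreover then have "invariant (f * h)" "invariant (f + h)"
      by (simp_all add: invariant_def twist_def eval_vars_mult eval_vars_add)
    ultimately show "C \<otimes>\<^bsub>Sym scale\<^esub> D \<in> carrier invariant_ring"
      "C \<oplus>\<^bsub>Sym scale\<^esub> D \<in> carrier invariant_ring"
      by (auto simp: carrier_invariant_ring sym_class_mult sym_class_add)
  qed
  then have "cring ((Sym scale)\<lparr>carrier := carrier invariant_ring\<rparr>)"
    using Sym.subcring_iff[of "carrier invariant_ring"] Sym.subcringI'
    by (auto simp: carrier_invariant_ring carrier_Sym)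
  then show ?thesis
    by (simp add: invariant_ring_def)
qed

lemma pow_invariant_ring: "cls f [^]\<^bsub>invariant_ring\<^esub> (n::nat) = cls (f ^ n)"
proof -
  interpret R: cring invariant_ring by (rule cring_invariant_ring)
  show ?thesis
    by (induction n) (simp_all add: invariant_ring_simps mult.commute)
qed

lemma has_char_invariant_ring: "has_char invariant_ring p"
proof -
  interpret R: cring invariant_ring by (rule cring_invariant_ring)
  have "add_pow invariant_ring n \<one>\<^bsub>invariant_ring\<^esub> = cls (of_nat n)" for n :: nat
    by (induction n) (simp_all add: invariant_ring_simps add.commute)
  moreover have "normal_form (of_nat n) = (of_nat n :: ('v, 'k) vpoly)" for n
    using eval_vars_const[of coord_form "of_nat n"] by (simp add: sym_const_def)
  moreover have "(of_nat n :: ('v, 'k) vpoly) = 0 \<longleftrightarrow> p dvd n" for n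
    using p(1) by (simp add: of_nat_eq_0_iff_char_dvd CHAR_vpoly)
  ultimately show ?thesis
    by (simp add: has_char_def invariant_ring_simps sym_class_eq_iff_normal_form)
qed

text \<open>
  The splitting is transported to the symmetric algebra through normal forms because it does not
  preserve \<open>sym_ideal\<close>: it sends \<open>x\<^bsub>v+w\<^esub>\<^bsup>p-1\<^esup> (x\<^bsub>v+w\<^esub> - x\<^bsub>v\<^esub> - x\<^bsub>w\<^esub>)\<close> to \<open>x\<^bsub>v+w\<^esub>\<close>
  if \<open>v\<close>, \<open>w\<close> and \<open>v + w\<close> are nonzero.
\<close>

definition class_splitting :: "('v, 'k) vpoly set \<Rightarrow> ('v, 'k) vpoly set" where
  "class_splitting C = cls (splitting (normal_form (SOME f. C = cls f)))"

lemma class_splitting_cls: "class_splitting (cls f) = cls (splitting (normal_form f))"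
proof -
  have "cls f = cls (SOME h. cls f = cls h)" by (rule someI) (rule refl)
  then show ?thesis
    unfolding class_splitting_def by (simp add: sym_class_eq_iff_normal_form)
qed

lemma invariant_splitting:
  assumes "invariant f" shows "invariant (splitting (normal_form f))"
  unfolding invariant_def
proof
  fix g assume g: "g \<in> carrier G"
  have sup: "supported (normal_form f)"
    by (intro supported_eval_vars supported_coord_form)
  have "twist g (splitting (normal_form f)) = splitting (twist g (normal_form f))"
    by (rule splitting_twist[OF g sup, symmetric])
  also have "\<dots> = splitting (normal_form f)"
    using assms g by (simp add: twist_normal_form invariant_def)
  also have "\<dots> = normal_form (splitting (normal_form f))"
    by (rule normal_form_supported[symmetric], rule supported_splitting[OF sup])
  finally show "twist g (splitting (normal_form f)) = normal_form (splitting (normal_form f))" .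
qed

lemma class_splitting_smult:
  "class_splitting (cls (f ^ p * h)) = cls (f * splitting (normal_form h))"
proof -
  have "class_splitting (cls (f ^ p * h)) = cls (normal_form f * splitting (normal_form h))"
    by (simp add: class_splitting_cls eval_vars_mult eval_vars_power splitting_power_mult)
  also have "\<dots> = cls (f * splitting (normal_form h))"
    by (simp add: sym_class_normal_form flip: sym_class_mult)
  finally show ?thesis .
qed

theorem F_pure_invariant_ring: "F_pure TYPE('m) p invariant_ring"
proof -
  let ?R = invariant_ring
  interpret R: cring ?R by (rule cring_invariant_ring)
  have F: "frobenius p ?R (cls f) = cls (f ^ p)" for f
    by (simp add: frobenius_def pow_invariant_ring)
  have "frobenius p ?R \<in> ring_hom ?R ?R"
  proof (rule ring_hom_memI)
    fix C assume "C \<in> carrier ?R"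
    then show "frobenius p ?R C \<in> carrier ?R" by (simp add: frobenius_def)
  next
    fix C D assume "C \<in> carrier ?R" "D \<in> carrier ?R"
    then obtain f h where CD: "C = cls f" "D = cls h"
      by (auto simp: carrier_invariant_ring)
    show "frobenius p ?R (C \<otimes>\<^bsub>?R\<^esub> D) = frobenius p ?R C \<otimes>\<^bsub>?R\<^esub> frobenius p ?R D"
      by (simp add: CD F invariant_ring_simps power_mult_distrib)
    show "frobenius p ?R (C \<oplus>\<^bsub>?R\<^esub> D) = frobenius p ?R C \<oplus>\<^bsub>?R\<^esub> frobenius p ?R D"
      by (simp add: CD F invariant_ring_simps frobenius_add)
  next
    show "frobenius p ?R \<one>\<^bsub>?R\<^esub> = \<one>\<^bsub>?R\<^esub>" by (simp add: frobenius_def)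
  qed
  then have "pure_ring_hom TYPE('m) ?R ?R (frobenius p ?R)"
  proof (rule pure_ring_hom_if_split[OF R.cring_axioms R.cring_axioms, where \<psi> = class_splitting])
    fix C assume "C \<in> carrier ?R"
    then obtain f where f: "C = cls f" "invariant f"
      by (auto simp: carrier_invariant_ring)
    then show "class_splitting C \<in> carrier ?R"
      by (auto simp: carrier_invariant_ring class_splitting_cls invariant_splitting)
    \<comment> \<open>The retraction property is linearity applied to the splitting of \<open>1\<close>.\<close>
    have "class_splitting (cls (f ^ p * 1)) = cls (f * 1)"
      unfolding class_splitting_smult by (simp add: splitting_1)
    then show "class_splitting (frobenius p ?R C) = C"
      by (simp add: f F)
  next
    fix C D assume "C \<in> carrier ?R" "D \<in> carrier ?R"
    then obtain f h where CD: "C = cls f" "D = cls h"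
      by (auto simp: carrier_invariant_ring)
    show "class_splitting (C \<oplus>\<^bsub>?R\<^esub> D) = class_splitting C \<oplus>\<^bsub>?R\<^esub> class_splitting D"
      by (simp add: CD invariant_ring_simps class_splitting_cls eval_vars_add splitting_add)
    show "class_splitting (frobenius p ?R C \<otimes>\<^bsub>?R\<^esub> D) = C \<otimes>\<^bsub>?R\<^esub> class_splitting D"
      by (simp only: CD F invariant_ring_simps class_splitting_smult)
         (simp only: class_splitting_cls invariant_ring_simps)
  qed
  then show ?thesis
    using p(2) has_char_invariant_ring R.cring_axioms by (simp add: F_pure_def)
qed

end

theorem mainTheorem4:
  fixes scale :: "'k::field \<Rightarrow> 'v::ab_group_add \<Rightarrow> 'v"
    and G :: "('g, 'x) monoid_scheme"
    and act :: "'g \<Rightarrow> 'v \<Rightarrow> 'v"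
  assumes "CHAR('k) > 0"
    and "finite (carrier G)"
    and "linear_representation scale G act"
    and "\<exists>B. finite_dimensional_vector_space scale B"
    and "linear_representation.monomial_representation scale G act"
  shows "F_pure TYPE('m) CHAR('k) (linear_representation.invariant_ring scale G act)"
proof -
  interpret linear_representation scale G act by fact
  obtain \<Gamma> where \<Gamma>: "monomial_basis \<Gamma>"
    using assms(5) by (auto simp: monomial_representation_def)
  obtain B where "finite_dimensional_vector_space scale B"
    using assms(4) by blast
  then have "finite \<Gamma>"
    using \<Gamma> finite_dimensional_vector_space.finiteI_independent by (auto simp: monomial_basis_def)
  obtain \<tau> :: "'k \<Rightarrow> 'k" where \<tau>: "\<tau> 1 = 1" "\<And>a b. \<tau> (a + b) = \<tau> a + \<tau> b"
    "\<And>a b. \<tau> (a ^ CHAR('k) * b) = a * \<tau> b"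
    using exists_p_inverse_linear[OF assms(1)] by blast
  interpret monomial_action scale G act \<Gamma> "CHAR('k)" \<tau>
    by unfold_locales (use \<Gamma> \<tau> \<open>finite \<Gamma>\<close> assms(1) in \<open>auto simp: monomial_basis_def\<close>)
  show ?thesis by (rule F_pure_invariant_ring)
qed

end
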